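(* Let $A,B>0$, $n\ge1$, and for $\theta\in\mathbb{R}$ let $X=(X_1,\ldots,X_n)$ with $X_1,\dots,X_n$ independently distributed as $U(\theta-A,\theta+A)$, independently of $Y\sim U(\theta-B,\theta+B)$. Let $X_{(1)}=\min\{X_1,\ldots,X_n\}$ and $X_{(n)}=\max\{X_1,\ldots,X_n\}$. Then, whenever $B\ge A/2$, a Bayesian predictive density for $Y$ associated with the uniform prior density $\pi(\theta)=1$ on $\mathbb{R}$ and under the $L_1$ loss $L(\theta,\hat q)=\int_{\mathbb{R}}|q_\theta(y)-\hat q(y)|\,dy$, where $q_\theta(y)=\frac{1}{2B}\mathbb{I}_{(\theta-B,\theta+B)}(y)$, is given by the $U\left(\frac{X_{(1)}+X_{(n)}}{2}-B,\ \frac{X_{(1)}+X_{(n)}}{2}+B\right)$ density.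
   Context: $U(a,b)$ is the uniform distribution on the interval $(a,b)$. A Bayesian predictive density (with respect to a possibly improper prior $\pi$ with proper posterior) is a $\hat q(\cdot;x)$ which, for each observed $x$ for which the posterior exists, minimizes the expected posterior loss $\mathbb{E}\{L(\theta,\hat q)\mid x\}$ among all Lebesgue densities $\hat q$ on $\mathbb{R}$, the expectation being taken over the posterior distribution of $\theta$ given $X=x$, whose density is proportional to the likelihood of $x$ times $\pi(\theta)$. *)

theory Defs
  imports "HOL-Probability.Probability"
begin

definition uniform_density :: "real \<Rightarrow> real \<Rightarrow> real \<Rightarrow> real" where
  "uniform_density a b y = 1 / (b - a) * indicator {a<..<b} y"

definition lebesgue_density :: "(real \<Rightarrow> real) \<Rightarrow> bool" where
  "lebesgue_density q \<longleftrightarrow>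
     q \<in> borel_measurable borel \<and> (\<forall>y. 0 \<le> q y) \<and> (\<integral>\<^sup>+ y. ennreal (q y) \<partial>lborel) = 1"

text \<open>
  A sample indexed by a finite set \<open>I\<close> is a function, of which only the values on \<open>I\<close> matter.
\<close>

definition sample_likelihood :: "('t \<Rightarrow> real \<Rightarrow> real) \<Rightarrow> 'i set \<Rightarrow> 't \<Rightarrow> ('i \<Rightarrow> real) \<Rightarrow> real" where
  "sample_likelihood p I \<theta> x = (\<Prod>i\<in>I. p \<theta> (x i))"

lemma (in prob_space) distributed_sample_likelihood:
  fixes X :: "'i \<Rightarrow> 'a \<Rightarrow> real" and p :: "'t \<Rightarrow> real \<Rightarrow> real"
  assumes I: "finite I" "I \<noteq> {}"
    and p: "p \<theta> \<in> borel_measurable borel" "\<And>y. 0 \<le> p \<theta> y"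
    and X: "\<And>i. i \<in> I \<Longrightarrow> distributed M lborel (X i) (\<lambda>y. ennreal (p \<theta> y))"
    and indep: "indep_vars (\<lambda>_. borel) X I"
  shows "distributed M (\<Pi>\<^sub>M i\<in>I. lborel) (\<lambda>\<omega>. \<lambda>i\<in>I. X i \<omega>)
           (\<lambda>x. ennreal (sample_likelihood p I \<theta> x))"
proof -
  interpret L: product_sigma_finite "\<lambda>_::'i. lborel :: real measure" by standard
  have Xm: "X i \<in> measurable M lborel" if "i \<in> I" for i
    using X[OF that] by (simp add: distributed_def)
  have meas: "(\<lambda>x. ennreal (sample_likelihood p I \<theta> x)) \<in> borel_measurable (\<Pi>\<^sub>M i\<in>I. lborel)"
    using p(1) unfolding sample_likelihood_def by measurable
  have "indep_vars (\<lambda>_. lborel) X I"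
    using indep by (simp add: indep_vars_def2)
  then have "distr M (\<Pi>\<^sub>M i\<in>I. lborel) (\<lambda>\<omega>. \<lambda>i\<in>I. X i \<omega>) = (\<Pi>\<^sub>M i\<in>I. distr M lborel (X i))"
    using I Xm by (subst (asm) indep_vars_iff_distr_eq_PiM') auto
  also have "\<dots> = (\<Pi>\<^sub>M i\<in>I. density lborel (\<lambda>y. ennreal (p \<theta> y)))"
    using X by (intro PiM_cong) (auto simp: distributed_def)
  also have "\<dots> = density (\<Pi>\<^sub>M i\<in>I. lborel) (\<lambda>x. ennreal (sample_likelihood p I \<theta> x))"
  proof (rule sym, rule product_sigma_finite.PiM_eqI)
    obtain i where i: "i \<in> I" using I by auto
    have "prob_space (density lborel (\<lambda>y. ennreal (p \<theta> y)))"
      using prob_space_distr[OF Xm[OF i]] X[OF i] by (simp add: distributed_def)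
    then show "product_sigma_finite (\<lambda>_. density lborel (\<lambda>y. ennreal (p \<theta> y)))"
      by (intro product_sigma_finite.intro prob_space_imp_sigma_finite)
    show "sets (density (\<Pi>\<^sub>M i\<in>I. lborel) (\<lambda>x. ennreal (sample_likelihood p I \<theta> x))) =
          sets (\<Pi>\<^sub>M i\<in>I. density lborel (\<lambda>y. ennreal (p \<theta> y)))"
      by (simp cong: sets_PiM_cong)
  next
    fix A :: "'i \<Rightarrow> real set"
    assume A: "\<And>i. i \<in> I \<Longrightarrow> A i \<in> sets (density lborel (\<lambda>y. ennreal (p \<theta> y)))"
    then have A': "A i \<in> sets lborel" if "i \<in> I" for i using that by simp
    have "emeasure (density (\<Pi>\<^sub>M i\<in>I. lborel) (\<lambda>x. ennreal (sample_likelihood p I \<theta> x))) (Pi\<^sub>E I A)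
        = (\<integral>\<^sup>+ x. ennreal (sample_likelihood p I \<theta> x) * indicator (Pi\<^sub>E I A) x \<partial>(\<Pi>\<^sub>M i\<in>I. lborel))"
      using I(1) A' by (intro emeasure_density[OF meas] sets_PiM_I_finite) auto
    also have "\<dots> = (\<integral>\<^sup>+ x. (\<Prod>i\<in>I. ennreal (p \<theta> (x i)) * indicator (A i) (x i)) \<partial>(\<Pi>\<^sub>M i\<in>I. lborel))"
    proof (intro nn_integral_cong)
      fix x assume "x \<in> space (\<Pi>\<^sub>M i\<in>I. (lborel :: real measure))"
      then have "indicator (Pi\<^sub>E I A) x = (\<Prod>i\<in>I. indicator (A i) (x i) :: ennreal)"
        using I(1) by (auto simp: space_PiM PiE_iff indicator_def prod_zero_iff split: if_splits)
      then show "ennreal (sample_likelihood p I \<theta> x) * indicator (Pi\<^sub>E I A) x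
          = (\<Prod>i\<in>I. ennreal (p \<theta> (x i)) * indicator (A i) (x i))"
        using p(2) by (simp add: sample_likelihood_def prod.distrib prod_ennreal)
    qed
    also have "\<dots> = (\<Prod>i\<in>I. \<integral>\<^sup>+ y. ennreal (p \<theta> y) * indicator (A i) y \<partial>lborel)"
      using I(1) A' p(1) by (intro L.product_nn_integral_prod) auto
    also have "\<dots> = (\<Prod>i\<in>I. emeasure (density lborel (\<lambda>y. ennreal (p \<theta> y))) (A i))"
      using A' p(1) by (intro prod.cong) (auto simp: emeasure_density)
    finally show "emeasure (density (\<Pi>\<^sub>M i\<in>I. lborel) (\<lambda>x. ennreal (sample_likelihood p I \<theta> x))) (Pi\<^sub>E I A)
        = (\<Prod>i\<in>I. emeasure (density lborel (\<lambda>y. ennreal (p \<theta> y))) (A i))" .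
  qed (rule I(1))
  finally show ?thesis
    using meas Xm by (auto simp: distributed_def intro!: measurable_restrict)
qed

definition marginal_likelihood :: "(real \<Rightarrow> 'x \<Rightarrow> real) \<Rightarrow> (real \<Rightarrow> real) \<Rightarrow> 'x \<Rightarrow> ennreal" where
  "marginal_likelihood lik prior x = (\<integral>\<^sup>+ \<theta>. ennreal (lik \<theta> x * prior \<theta>) \<partial>lborel)"

definition posterior_exists :: "(real \<Rightarrow> 'x \<Rightarrow> real) \<Rightarrow> (real \<Rightarrow> real) \<Rightarrow> 'x \<Rightarrow> bool" where
  "posterior_exists lik prior x \<longleftrightarrow>
     (\<lambda>\<theta>. lik \<theta> x * prior \<theta>) \<in> borel_measurable borel \<and>
     0 < marginal_likelihood lik prior x \<and> marginal_likelihood lik prior x < \<infinity>"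

definition posterior :: "(real \<Rightarrow> 'x \<Rightarrow> real) \<Rightarrow> (real \<Rightarrow> real) \<Rightarrow> 'x \<Rightarrow> real measure" where
  "posterior lik prior x =
     density lborel (\<lambda>\<theta>. ennreal (lik \<theta> x * prior \<theta>) / marginal_likelihood lik prior x)"

definition expected_posterior_loss ::
  "(real \<Rightarrow> 'x \<Rightarrow> real) \<Rightarrow> (real \<Rightarrow> real) \<Rightarrow> (real \<Rightarrow> (real \<Rightarrow> real) \<Rightarrow> ennreal)
    \<Rightarrow> 'x \<Rightarrow> (real \<Rightarrow> real) \<Rightarrow> ennreal" where
  "expected_posterior_loss lik prior loss x q = (\<integral>\<^sup>+ \<theta>. loss \<theta> q \<partial>posterior lik prior x)"

definition bayes_predictive_density ::
  "(real \<Rightarrow> 'x \<Rightarrow> real) \<Rightarrow> (real \<Rightarrow> real) \<Rightarrow> (real \<Rightarrow> (real \<Rightarrow> real) \<Rightarrow> ennreal)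
    \<Rightarrow> ('x \<Rightarrow> real \<Rightarrow> real) \<Rightarrow> bool" where
  "bayes_predictive_density lik prior loss qhat \<longleftrightarrow>
     (\<forall>x. posterior_exists lik prior x \<longrightarrow>
        lebesgue_density (qhat x) \<and>
        (\<forall>q. lebesgue_density q \<longrightarrow>
           expected_posterior_loss lik prior loss x (qhat x)
             \<le> expected_posterior_loss lik prior loss x q))"

definition L1_loss :: "(real \<Rightarrow> real \<Rightarrow> real) \<Rightarrow> real \<Rightarrow> (real \<Rightarrow> real) \<Rightarrow> ennreal" where
  "L1_loss q \<theta> qhat = (\<integral>\<^sup>+ y. ennreal \<bar>q \<theta> y - qhat y\<bar> \<partial>lborel)"

end

theory Submission
  imports Defs
begin

text \<open>
  The posterior of \<open>\<theta>\<close> is uniform on \<open>(m - r, m + r)\<close>, with \<open>m\<close> the midrange and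
  \<open>r = A - (X\<^bsub>(n)\<^esub> - X\<^bsub>(1)\<^esub>) / 2 \<le> A \<le> 2B\<close>. By Tonelli, the expected posterior loss of \<open>q\<close> is
  the integral over \<open>y\<close> of \<open>P(y) \<bar>1/(2B) - q y\<bar> + (1 - P(y)) q y\<close>, where \<open>P(y)\<close> is the
  posterior probability of \<open>\<bar>\<theta> - y\<bar> < B\<close>. For each \<open>y\<close> this integrand is minimal at
  \<open>q y = 1/(2B)\<close> if \<open>P(y) \<ge> 1/2\<close> and at \<open>q y = 0\<close> if \<open>P(y) \<le> 1/2\<close>. As \<open>r \<le> 2B\<close>, the former
  holds for \<open>\<bar>y - m\<bar> \<le> B\<close> and the latter for \<open>\<bar>y - m\<bar> \<ge> B\<close>, so the pointwise minimiser happens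
  to be the density of \<open>U(m - B, m + B)\<close>, and the constraint of total mass 1 plays no role.
\<close>

lemma uniform_density_nonneg: "a < b \<Longrightarrow> 0 \<le> uniform_density a b y"
  by (simp add: uniform_density_def)

lemma measurable_uniform_density[measurable]:
  "uniform_density a b \<in> borel_measurable borel"
  unfolding uniform_density_def[abs_def] by measurable

text \<open>The support and the window meet in the single interval from \<open>max a c\<close> to
  \<open>min b d\<close>; cutting the length off at 0 covers an empty intersection.\<close>

lemma emeasure_density_uniform_density:
  assumes "a < b"
  shows "emeasure (density lborel (\<lambda>t. ennreal (uniform_density a b t))) {c<..<d}
    = ennreal (max 0 (min b d - max a c) / (b - a))"
proof -
  have "emeasure (density lborel (\<lambda>t. ennreal (uniform_density a b t))) {c<..<d}
      = (\<integral>\<^sup>+ t. ennreal (1 / (b - a)) * indicator {max a c<..<min b d} t \<partial>lborel)"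
    by (subst emeasure_density, measurable)
       (auto intro!: nn_integral_cong simp: uniform_density_def indicator_def)
  also have "\<dots> = ennreal (1 / (b - a)) * emeasure lborel {max a c<..<min b d}"
    by (simp add: nn_integral_cmult_indicator)
  also have "\<dots> = ennreal (1 / (b - a)) * ennreal (max 0 (min b d - max a c))"
    by (cases "max a c \<le> min b d") (auto simp: max_def)
  also have "\<dots> = ennreal (max 0 (min b d - max a c) / (b - a))"
    using assms by (subst ennreal_mult[symmetric]) auto
  finally show ?thesis .
qed

lemma lebesgue_density_uniform_density:
  assumes "a < b"
  shows "lebesgue_density (uniform_density a b)"
proof -
  have "(\<integral>\<^sup>+ y. ennreal (uniform_density a b y) \<partial>lborel)
      = (\<integral>\<^sup>+ y. ennreal (1 / (b - a)) * indicator {a<..<b} y \<partial>lborel)"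
    by (intro nn_integral_cong) (auto simp: uniform_density_def indicator_def)
  also have "\<dots> = ennreal (1 / (b - a)) * ennreal (b - a)"
    using assms by (simp add: nn_integral_cmult_indicator)
  also have "\<dots> = 1"
    using assms by (subst ennreal_mult[symmetric]) auto
  finally show ?thesis
    using assms by (auto simp: lebesgue_density_def uniform_density_nonneg)
qed

lemma prob_space_lebesgue_density:
  "lebesgue_density q \<Longrightarrow> prob_space (density lborel (\<lambda>t. ennreal (q t)))"
  by (intro prob_spaceI) (simp add: lebesgue_density_def emeasure_density)

text \<open>All observations lie within \<open>A\<close> of \<open>\<theta>\<close> exactly when the
  two extreme ones do. So, as a function of \<open>\<theta>\<close>, the likelihood is constant on
  one interval, possibly empty, and 0 outside it.\<close>

lemma sample_likelihood_uniform_density: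
  fixes x :: "'i \<Rightarrow> real"
  assumes "finite I" "I \<noteq> {}"
  shows "sample_likelihood (\<lambda>\<theta>. uniform_density (\<theta> - A) (\<theta> + A)) I \<theta> x
    = (1 / (2 * A)) ^ card I * indicator {Max (x ` I) - A<..<Min (x ` I) + A} \<theta>"
proof -
  have mem: "\<theta> \<in> {Max (x ` I) - A<..<Min (x ` I) + A} \<longleftrightarrow> (\<forall>i\<in>I. x i \<in> {\<theta> - A<..<\<theta> + A})"
  proof -
    have "Max (x ` I) < \<theta> + A \<longleftrightarrow> (\<forall>i\<in>I. x i < \<theta> + A)"
      "\<theta> - A < Min (x ` I) \<longleftrightarrow> (\<forall>i\<in>I. \<theta> - A < x i)"
      using assms by simp_all
    moreover have "\<theta> \<in> {Max (x ` I) - A<..<Min (x ` I) + A}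
      \<longleftrightarrow> Max (x ` I) < \<theta> + A \<and> \<theta> - A < Min (x ` I)"
      by auto
    ultimately show ?thesis by auto
  qed
  have "sample_likelihood (\<lambda>\<theta>. uniform_density (\<theta> - A) (\<theta> + A)) I \<theta> x
      = (1 / (2 * A)) ^ card I * (\<Prod>i\<in>I. indicator {\<theta> - A<..<\<theta> + A} (x i))"
    by (simp add: sample_likelihood_def uniform_density_def prod.distrib power_divide prod_dividef)
  also have "(\<Prod>i\<in>I. indicator {\<theta> - A<..<\<theta> + A} (x i))
      = (indicator {Max (x ` I) - A<..<Min (x ` I) + A} \<theta> :: real)"
  proof (cases "\<forall>i\<in>I. x i \<in> {\<theta> - A<..<\<theta> + A}")
    case True
    then show ?thesis using mem by simp
  next
    case False
    then have "(\<Prod>i\<in>I. indicator {\<theta> - A<..<\<theta> + A} (x i)) = (0 :: real)"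
      using assms(1) by (auto simp: prod_zero_iff indicator_def)
    with False mem show ?thesis by (simp add: indicator_def)
  qed
  finally show ?thesis .
qed

text \<open>The marginal likelihood is \<open>k\<close> times the length of the interval. It
  vanishes when the interval is empty, which a proper posterior excludes; otherwise \<open>k\<close>
  cancels on normalisation.\<close>

lemma
  assumes lik: "\<And>\<theta>. lik \<theta> x * prior \<theta> = k * indicator {a<..<b} \<theta>" and k: "0 < k"
  shows posterior_exists_flatD: "posterior_exists lik prior x \<Longrightarrow> a < b"
    and posterior_flat:
      "a < b \<Longrightarrow> posterior lik prior x = density lborel (\<lambda>\<theta>. ennreal (uniform_density a b \<theta>))"
proof -
  have "marginal_likelihood lik prior x = (\<integral>\<^sup>+ \<theta>. ennreal k * indicator {a<..<b} \<theta> \<partial>lborel)"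
    unfolding marginal_likelihood_def lik
    by (intro nn_integral_cong) (auto simp: indicator_def)
  then have marginal: "marginal_likelihood lik prior x = ennreal k * emeasure lborel {a<..<b}"
    by (simp add: nn_integral_cmult_indicator)
  {
    assume "posterior_exists lik prior x"
    then show "a < b"
      by (cases "a < b") (auto simp: posterior_exists_def marginal)
  next
    assume "a < b"
    then have "marginal_likelihood lik prior x = ennreal (k * (b - a))"
      using k by (simp add: marginal ennreal_mult)
    then show "posterior lik prior x = density lborel (\<lambda>\<theta>. ennreal (uniform_density a b \<theta>))"
      unfolding posterior_def lik using \<open>a < b\<close> k
      by (auto intro!: arg_cong[where f = "density lborel"]
          simp: fun_eq_iff divide_ennreal uniform_density_def indicator_def)
  }
qed

text \<open>The integrand takes two values only: \<open>\<bar>h - c\<bar>\<close> on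
  \<open>S\<close> and, as \<open>c\<close> is nonnegative, \<open>c\<close> off
  \<open>S\<close>.\<close>

lemma (in prob_space) nn_integral_abs_indicator_diff:
  assumes S: "S \<in> events" and "0 \<le> c"
  shows "(\<integral>\<^sup>+ \<omega>. ennreal \<bar>h * indicator S \<omega> - c\<bar> \<partial>M)
    = ennreal (\<bar>h - c\<bar> * prob S + c * (1 - prob S))"
proof -
  have "(\<integral>\<^sup>+ \<omega>. ennreal \<bar>h * indicator S \<omega> - c\<bar> \<partial>M)
      = (\<integral>\<^sup>+ \<omega>. ennreal \<bar>h - c\<bar> * indicator S \<omega> + ennreal c * indicator (space M - S) \<omega> \<partial>M)"
    using \<open>0 \<le> c\<close> by (intro nn_integral_cong) (auto simp: indicator_def)
  also have "\<dots> = ennreal \<bar>h - c\<bar> * emeasure M S + ennreal c * emeasure M (space M - S)"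
    using S by (subst nn_integral_add) (auto simp: nn_integral_cmult_indicator)
  also have "\<dots> = ennreal (\<bar>h - c\<bar> * prob S + c * (1 - prob S))"
    using S \<open>0 \<le> c\<close>
    by (simp add: emeasure_eq_measure prob_compl ennreal_mult[symmetric] ennreal_plus[symmetric]
        del: ennreal_plus)
  finally show ?thesis .
qed

lemma nn_integral_L1_loss_uniform:
  fixes M :: "real measure" and B :: real
  assumes prob: "prob_space M" and sets: "sets M = sets borel" and q: "lebesgue_density q"
  shows "(\<integral>\<^sup>+ \<theta>. L1_loss (\<lambda>\<theta>. uniform_density (\<theta> - B) (\<theta> + B)) \<theta> q \<partial>M)
    = (\<integral>\<^sup>+ y. ennreal (\<bar>1 / (2 * B) - q y\<bar> * measure M {y - B<..<y + B}
                     + q y * (1 - measure M {y - B<..<y + B})) \<partial>lborel)"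
proof -
  interpret prob_space M by (rule prob)
  interpret P: pair_sigma_finite M lborel ..
  note sets[measurable_cong]
  have [measurable]: "q \<in> borel_measurable borel" and q0: "\<And>y. 0 \<le> q y"
    using q by (auto simp: lebesgue_density_def)
  \<comment> \<open>\<open>\<bar>\<theta> - y\<bar> < B\<close> is symmetric in
    \<open>\<theta>\<close> and \<open>y\<close>, so for fixed \<open>y\<close> the density becomes
    an indicator in \<open>\<theta>\<close>, ready for the inner integral over
    \<open>M\<close>.\<close>
  have eq: "uniform_density (\<theta> - B) (\<theta> + B) y = 1 / (2 * B) * indicator {y - B<..<y + B} \<theta>"
    for \<theta> y
    by (auto simp: uniform_density_def indicator_def)
  \<comment> \<open>The interval moves with \<open>y\<close>; written as a conditional on two
    inequalities, the integrand is visibly jointly measurable.\<close>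
  have "(\<lambda>(\<theta>, y). ennreal \<bar>1 / (2 * B) * indicator {y - B<..<y + B} \<theta> - q y\<bar>)
      = (\<lambda>(\<theta>, y). ennreal \<bar>1 / (2 * B) * (if y - B < \<theta> \<and> \<theta> < y + B then 1 else 0) - q y\<bar>)"
    by (auto simp: fun_eq_iff indicator_def)
  also have "\<dots> \<in> borel_measurable (M \<Otimes>\<^sub>M lborel)"
    by measurable
  finally have "(\<integral>\<^sup>+ \<theta>. L1_loss (\<lambda>\<theta>. uniform_density (\<theta> - B) (\<theta> + B)) \<theta> q \<partial>M)
      = (\<integral>\<^sup>+ y. \<integral>\<^sup>+ \<theta>. ennreal \<bar>1 / (2 * B) * indicator {y - B<..<y + B} \<theta> - q y\<bar> \<partial>M \<partial>lborel)"
    unfolding L1_loss_def eq by (rule P.Fubini'[symmetric])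
  then show ?thesis
    using q0 by (simp add: nn_integral_abs_indicator_diff sets del: times_divide_eq_left)
qed

text \<open>At \<open>\<bar>y - m\<bar> = B\<close> the window has one end at \<open>m\<close> and
  the other at distance \<open>2 * B\<close>, at least \<open>r\<close>, so it covers exactly half
  of the support. The overlap does not grow as \<open>y\<close> moves away from
  \<open>m\<close>.\<close>

lemma uniform_prob_window:
  fixes m r B y :: real
  assumes r: "0 < r" "r \<le> 2 * B"
  defines "P \<equiv> measure (density lborel (\<lambda>t. ennreal (uniform_density (m - r) (m + r) t)))
                 {y - B<..<y + B}"
  shows "\<bar>y - m\<bar> \<le> B \<Longrightarrow> 1 / 2 \<le> P" and "B \<le> \<bar>y - m\<bar> \<Longrightarrow> P \<le> 1 / 2"
proof -
  have P: "P = max 0 (min (m + r) (y + B) - max (m - r) (y - B)) / (2 * r)"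
    using r unfolding P_def measure_def by (simp add: emeasure_density_uniform_density)
  show "1 / 2 \<le> P" if "\<bar>y - m\<bar> \<le> B"
    using r that by (auto simp: P field_simps max_def min_def abs_if split: if_splits)
  show "P \<le> 1 / 2" if "B \<le> \<bar>y - m\<bar>"
    using r that by (auto simp: P field_simps max_def min_def abs_if split: if_splits)
qed

text \<open>The left-hand sides are the values of the right-hand side at \<open>c = h\<close> and at
  \<open>c = 0\<close>.\<close>

lemma pointwise_loss_minimised:
  fixes P h c :: real
  assumes "0 \<le> P" "P \<le> 1" "0 \<le> h" "0 \<le> c"
  shows "1 / 2 \<le> P \<Longrightarrow> h * (1 - P) \<le> \<bar>h - c\<bar> * P + c * (1 - P)"
    and "P \<le> 1 / 2 \<Longrightarrow> h * P \<le> \<bar>h - c\<bar> * P + c * (1 - P)"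
proof -
  \<comment> \<open>Split \<open>h\<close> as \<open>(h - c) + c\<close>, weighted by
    \<open>1 - P\<close> in the first case and by \<open>P\<close> in the second; what remains is to
    compare \<open>P\<close> with \<open>1 - P\<close>.\<close>
  have *: "(h - c) * P \<le> \<bar>h - c\<bar> * P" "(h - c) * (1 - P) \<le> \<bar>h - c\<bar> * (1 - P)"
    using assms by (auto intro!: mult_right_mono)
  show "h * (1 - P) \<le> \<bar>h - c\<bar> * P + c * (1 - P)" if "1 / 2 \<le> P"
  proof -
    have "\<bar>h - c\<bar> * (1 - P) \<le> \<bar>h - c\<bar> * P"
      using that by (intro mult_left_mono) auto
    with * show ?thesis by (simp add: algebra_simps)
  qed
  show "h * P \<le> \<bar>h - c\<bar> * P + c * (1 - P)" if "P \<le> 1 / 2"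
  proof -
    have "c * P \<le> c * (1 - P)"
      using that assms by (intro mult_left_mono) auto
    with * show ?thesis by (simp add: algebra_simps)
  qed
qed

lemma uniform_minimises_expected_L1_loss:
  fixes m r B :: real
  assumes r: "0 < r" "r \<le> 2 * B" and q: "lebesgue_density q"
  defines "N \<equiv> density lborel (\<lambda>t. ennreal (uniform_density (m - r) (m + r) t))"
  shows "(\<integral>\<^sup>+ \<theta>. L1_loss (\<lambda>\<theta>. uniform_density (\<theta> - B) (\<theta> + B)) \<theta> (uniform_density (m - B) (m + B)) \<partial>N)
    \<le> (\<integral>\<^sup>+ \<theta>. L1_loss (\<lambda>\<theta>. uniform_density (\<theta> - B) (\<theta> + B)) \<theta> q \<partial>N)"
proof -
  interpret prob_space N
    unfolding N_def using r by (intro prob_space_lebesgue_density lebesgue_density_uniform_density) simp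
  have N: "sets N = sets borel" by (simp add: N_def)
  have B: "0 < B" using r by simp
  have dens: "lebesgue_density (uniform_density (m - B) (m + B))"
    using B by (intro lebesgue_density_uniform_density) simp
  have q0: "0 \<le> q y" for y using q by (simp add: lebesgue_density_def)
  show ?thesis
    unfolding nn_integral_L1_loss_uniform[OF prob_space_axioms N dens] nn_integral_L1_loss_uniform[OF prob_space_axioms N q]
  proof (intro nn_integral_mono ennreal_leI)
    fix y
    let ?P = "prob {y - B<..<y + B}" and ?u = "uniform_density (m - B) (m + B) y"
    note window = uniform_prob_window[OF r, of y m, folded N_def]
    have min: "1 / 2 \<le> ?P \<Longrightarrow> 1 / (2 * B) * (1 - ?P) \<le> \<bar>1 / (2 * B) - q y\<bar> * ?P + q y * (1 - ?P)"
      "?P \<le> 1 / 2 \<Longrightarrow> 1 / (2 * B) * ?P \<le> \<bar>1 / (2 * B) - q y\<bar> * ?P + q y * (1 - ?P)"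
      using B q0 by (intro pointwise_loss_minimised; simp)+
    show "\<bar>1 / (2 * B) - ?u\<bar> * ?P + ?u * (1 - ?P) \<le> \<bar>1 / (2 * B) - q y\<bar> * ?P + q y * (1 - ?P)"
    \<comment> \<open>The boundary \<open>\<bar>y - m\<bar> = B\<close> belongs to the second case,
      because the open interval gives the density the value 0 there.\<close>
    proof (cases "\<bar>y - m\<bar> < B")
      case True
      then have "?u = 1 / (2 * B)" by (auto simp: uniform_density_def indicator_def)
      with True window(1) min(1) show ?thesis by simp
    next
      case False
      then have "?u = 0" by (auto simp: uniform_density_def indicator_def)
      with False window(2) min(2) B show ?thesis by simp
    qed
  qed
qed

theorem theorem1:
  fixes A B :: real and n :: nat
    and M :: "real \<Rightarrow> 'w measure"
    and X :: "nat \<Rightarrow> 'w \<Rightarrow> real" and Y :: "'w \<Rightarrow> real"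
    and p q :: "real \<Rightarrow> real \<Rightarrow> real"
  assumes "A > 0" and "B > 0" and "n \<ge> 1" and "B \<ge> A / 2"
    and p: "\<And>\<theta>. p \<theta> = uniform_density (\<theta> - A) (\<theta> + A)"
    and q: "\<And>\<theta>. q \<theta> = uniform_density (\<theta> - B) (\<theta> + B)"
    and "\<And>\<theta>. prob_space (M \<theta>)"
    and "\<And>\<theta> i. i \<in> {1..n} \<Longrightarrow> distributed (M \<theta>) lborel (X i) (\<lambda>x. ennreal (p \<theta> x))"
    and "\<And>\<theta>. distributed (M \<theta>) lborel Y (\<lambda>y. ennreal (q \<theta> y))"
    and "\<And>\<theta>. prob_space.indep_vars (M \<theta>) (\<lambda>_. borel) (\<lambda>i. if i = 0 then Y else X i) {0..n}"
  shows "bayes_predictive_density (sample_likelihood p {1..n}) (\<lambda>_. 1) (L1_loss q)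
           (\<lambda>x. let m = (Min (x ` {1..n}) + Max (x ` {1..n})) / 2
                 in uniform_density (m - B) (m + B))"
  unfolding bayes_predictive_density_def Let_def
proof (intro allI impI)
  fix x :: "nat \<Rightarrow> real"
  assume ex: "posterior_exists (sample_likelihood p {1..n}) (\<lambda>_. 1) x"
  define lo hi where "lo = Min (x ` {1..n})" and "hi = Max (x ` {1..n})"
  \<comment> \<open>Midpoint and half-length of the interval from \<open>hi - A\<close> to
    \<open>lo + A\<close> on which the likelihood is positive.\<close>
  define m r where "m = (lo + hi) / 2" and "r = A - (hi - lo) / 2"
  have p': "p = (\<lambda>\<theta>. uniform_density (\<theta> - A) (\<theta> + A))" and
    q': "q = (\<lambda>\<theta>. uniform_density (\<theta> - B) (\<theta> + B))"
    using p q by (auto simp: fun_eq_iff)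
  have ends: "m - r = hi - A" "m + r = lo + A"
    by (simp_all add: m_def r_def field_simps)
  have lik: "sample_likelihood p {1..n} \<theta> x * 1 = (1 / (2 * A)) ^ n * indicator {m - r<..<m + r} \<theta>"
    for \<theta>
    using sample_likelihood_uniform_density[of "{1..n}" A \<theta> x] \<open>n \<ge> 1\<close>
    unfolding p' ends lo_def hi_def by simp
  have k: "0 < (1 / (2 * A)) ^ n" using \<open>A > 0\<close> by simp
  have "m - r < m + r" by (rule posterior_exists_flatD[OF lik k ex])
  then have "0 < r" by simp
  \<comment> \<open>Any observation separates the extremes, and \<open>n \<ge> 1\<close> provides
    the first; hence \<open>r \<le> A\<close>.\<close>
  have "lo \<le> x 1" "x 1 \<le> hi"
    unfolding lo_def hi_def using \<open>n \<ge> 1\<close> by (auto intro!: Min_le Max_ge)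
  then have "lo \<le> hi" by simp
  then have "r \<le> 2 * B" using \<open>B \<ge> A / 2\<close> by (simp add: r_def field_simps)
  have post: "posterior (sample_likelihood p {1..n}) (\<lambda>_. 1) x
      = density lborel (\<lambda>\<theta>. ennreal (uniform_density (m - r) (m + r) \<theta>))"
    by (rule posterior_flat[where lik = "sample_likelihood p {1..n}" and prior = "\<lambda>_. 1" and x = x,
          OF lik k \<open>m - r < m + r\<close>])
  show "lebesgue_density (uniform_density ((Min (x ` {1..n}) + Max (x ` {1..n})) / 2 - B)
                                          ((Min (x ` {1..n}) + Max (x ` {1..n})) / 2 + B)) \<and>
    (\<forall>qa. lebesgue_density qa \<longrightarrow>
      expected_posterior_loss (sample_likelihood p {1..n}) (\<lambda>_. 1) (L1_loss q) x
        (uniform_density ((Min (x ` {1..n}) + Max (x ` {1..n})) / 2 - B)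
                         ((Min (x ` {1..n}) + Max (x ` {1..n})) / 2 + B))
      \<le> expected_posterior_loss (sample_likelihood p {1..n}) (\<lambda>_. 1) (L1_loss q) x qa)"
    unfolding expected_posterior_loss_def post
    unfolding q' lo_def[symmetric] hi_def[symmetric] m_def[symmetric]
    using uniform_minimises_expected_L1_loss[OF \<open>0 < r\<close> \<open>r \<le> 2 * B\<close>]
      lebesgue_density_uniform_density[of "m - B" "m + B"] \<open>B > 0\<close>
    by simp
qed

end
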